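(* If $d=(d_1,\ldots,d_n)$ is a non-increasing degree sequence of some forest without isolated vertices, then $$\gamma^{\mathcal F}_{\min}(d)=\min\{k_1,k_2\},$$ where $$k_1=\min\Big\{k\in[n]:\sum_{i=1}^k d_i\ge\sum_{i=k+1}^n d_i\Big\}$$ and $$k_2=\min\Big\{k\in[n]:\sum_{i=1}^k d_i\ge n-k\ \text{ and }\ 0\le\sum_{i=k+1}^n d_i-\sum_{i=1}^k d_i\le\max\{0,\,2(n_{\ge2}(d)-k)-2\}\Big\},$$ with the convention that the minimum of the empty set is $\infty$.
   Context: All graphs are finite, simple and undirected. $[n]=\{1,\ldots,n\}$; empty sums are $0$. For a sequence $d$ of non-negative integers, $n_{\ge2}(d)$ is the number of entries of $d$ that are at least $2$, and $\mathcal{F}(d)$ is the set of all forests with degree sequence $d$. A set $D$ of vertices of a graph $G$ is a dominating set if every vertex in $V(G)\setminus D$ has a neighbor in $D$; $\gamma(G)$ is the minimum order of a dominating set of $G$. $\gamma^{\mathcal F}_{\min}(d)=\min\{\gamma(F):F\in\mathcal{F}(d)\}$. *)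

theory Defs
  imports Main "HOL-Library.Multiset" "HOL-Library.Extended_Nat"
begin

type_synonym 'a ugraph = "'a set \<times> 'a set set"

abbreviation verts :: "'a ugraph \<Rightarrow> 'a set" where
  "verts G \<equiv> fst G"

abbreviation edges :: "'a ugraph \<Rightarrow> 'a set set" where
  "edges G \<equiv> snd G"

definition simple_graph :: "'a ugraph \<Rightarrow> bool" where
  "simple_graph G \<longleftrightarrow> finite (verts G) \<and> (\<forall>e \<in> edges G. e \<subseteq> verts G \<and> card e = 2)"

definition neighbors :: "'a ugraph \<Rightarrow> 'a \<Rightarrow> 'a set" where
  "neighbors G v = {u. {u, v} \<in> edges G}"

definition degree :: "'a ugraph \<Rightarrow> 'a \<Rightarrow> nat" where
  "degree G v = card (neighbors G v)"

definition is_cycle :: "'a ugraph \<Rightarrow> 'a list \<Rightarrow> bool" where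
  "is_cycle G c \<longleftrightarrow> 3 \<le> length c \<and> distinct c \<and>
     (\<forall>i < length c. {c ! i, c ! (Suc i mod length c)} \<in> edges G)"

definition forest :: "'a ugraph \<Rightarrow> bool" where
  "forest G \<longleftrightarrow> simple_graph G \<and> (\<nexists>c. is_cycle G c)"

definition has_degree_sequence :: "'a ugraph \<Rightarrow> nat list \<Rightarrow> bool" where
  "has_degree_sequence G d \<longleftrightarrow> image_mset (degree G) (mset_set (verts G)) = mset d"

(* Every finite graph is isomorphic to one whose vertices are natural numbers. *)
definition forests :: "nat list \<Rightarrow> nat ugraph set" where
  "forests d = {F. forest F \<and> has_degree_sequence F d}"

definition dominating_set :: "'a ugraph \<Rightarrow> 'a set \<Rightarrow> bool" where
  "dominating_set G D \<longleftrightarrow> D \<subseteq> verts G \<and> (\<forall>v \<in> verts G - D. \<exists>u \<in> D. u \<in> neighbors G v)"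

definition domination_number :: "'a ugraph \<Rightarrow> nat" where
  "domination_number G = Min {card D | D. dominating_set G D}"

(* The infima below are taken in enat, where Inf {} = \<infinity>; a nonempty set of
   extended naturals attains its infimum. *)
definition gamma_min :: "nat list \<Rightarrow> enat" where
  "gamma_min d = (INF F \<in> forests d. enat (domination_number F))"

definition n_ge2 :: "nat list \<Rightarrow> nat" where
  "n_ge2 d = length (filter (\<lambda>x. 2 \<le> x) d)"

(* Lists are indexed from 0, so the first k entries are d ! i with i < k. *)
definition k1 :: "nat list \<Rightarrow> enat" where
  "k1 d = Inf (enat ` {k \<in> {1..length d}.
     (\<Sum>i = 0..<k. d ! i) \<ge> (\<Sum>i = k..<length d. d ! i)})"

(* The differences are taken in int: truncated subtraction on nat would change the condition. *)
definition k2 :: "nat list \<Rightarrow> enat" where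
  "k2 d = Inf (enat ` {k \<in> {1..length d}.
     (\<Sum>i = 0..<k. int (d ! i)) \<ge> int (length d) - int k \<and>
     0 \<le> (\<Sum>i = k..<length d. int (d ! i)) - (\<Sum>i = 0..<k. int (d ! i)) \<and>
     (\<Sum>i = k..<length d. int (d ! i)) - (\<Sum>i = 0..<k. int (d ! i))
       \<le> max 0 (2 * (int (n_ge2 d) - int k) - 2)})"

end

theory Submission
  imports Defs "HOL-Combinatorics.List_Permutation"
begin

text \<open>
  Write \<open>S\<close> and \<open>T\<close> for the sums of the first \<open>k\<close> and of the remaining degrees.

  Lower bound: let \<open>D\<close> be a dominating set of \<open>k\<close> vertices. Counting edges gives
  \<open>n - k \<le> S\<close>, and the degree sums outside and inside \<open>D\<close> differ by at most twice the number
  of edges avoiding \<open>D\<close>. These edges form a forest on the vertices outside \<open>D\<close> of degree at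
  least 2, so there are fewer of them than such vertices.

  Upper bound: make the \<open>k\<close> largest vertices dominate all others. If \<open>\<bar>S - T\<bar> = 2 j\<close>, first put
  a forest with \<open>j\<close> edges inside the heavier side, using at most \<open>d\<^sub>i - 1\<close> of each degree, and
  then spend the remaining degrees, all positive and equal in sum on both sides, on edges between
  the sides. Each new edge joins two components. No cycle arises as long as more components
  than edges to be added still have degree left; this is preserved by always joining a component
  with a single unit left to one with more, if there is any.
\<close>

section \<open>Degree sums and edges of forests\<close>

lemma finite_edges:
  assumes "simple_graph G"
  shows "finite (edges G)"
proof (rule finite_subset)
  show "edges G \<subseteq> Pow (verts G)"
    using assms by (auto simp: simple_graph_def)
  show "finite (Pow (verts G))"
    using assms by (simp add: simple_graph_def)
qed

lemma neighbors_subset: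
  assumes "simple_graph G"
  shows "neighbors G v \<subseteq> verts G"
  using assms by (auto simp: simple_graph_def neighbors_def)

lemma finite_neighbors:
  assumes "simple_graph G"
  shows "finite (neighbors G v)"
  using neighbors_subset[OF assms, of v] assms finite_subset by (auto simp: simple_graph_def)

lemma edge_endpoints:
  assumes "simple_graph G" "{u, v} \<in> edges G"
  shows "u \<noteq> v" "u \<in> verts G" "v \<in> verts G"
proof -
  from assms have "card {u, v} = 2" "{u, v} \<subseteq> verts G"
    by (auto simp: simple_graph_def)
  then show "u \<noteq> v" "u \<in> verts G" "v \<in> verts G"
    by (auto simp: card_insert_if split: if_splits)
qed

lemma simple_edge_cases:
  assumes "simple_graph G" "e \<in> edges G"
  obtains u v where "e = {u, v}" "u \<noteq> v"
  using assms by (auto simp: simple_graph_def card_2_iff)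

lemma degree_eq_incident:
  assumes "simple_graph G"
  shows "degree G v = card {e \<in> edges G. v \<in> e}"
proof -
  have "bij_betw (\<lambda>u. {u, v}) (neighbors G v) {e \<in> edges G. v \<in> e}"
    unfolding bij_betw_def
  proof
    show "inj_on (\<lambda>u. {u, v}) (neighbors G v)"
      by (auto simp: inj_on_def doubleton_eq_iff)
    show "(\<lambda>u. {u, v}) ` neighbors G v = {e \<in> edges G. v \<in> e}"
    proof
      show "(\<lambda>u. {u, v}) ` neighbors G v \<subseteq> {e \<in> edges G. v \<in> e}"
        by (auto simp: neighbors_def)
      show "{e \<in> edges G. v \<in> e} \<subseteq> (\<lambda>u. {u, v}) ` neighbors G v"
      proof
        fix e assume e: "e \<in> {e \<in> edges G. v \<in> e}"
        then obtain a b where "e = {a, b}"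
          using simple_edge_cases[OF assms] by blast
        with e show "e \<in> (\<lambda>u. {u, v}) ` neighbors G v"
          by (auto simp: neighbors_def insert_commute)
      qed
    qed
  qed
  then show ?thesis
    unfolding degree_def by (rule bij_betw_same_card)
qed

text \<open>Double counting of the incidences between \<open>X\<close> and the edges.\<close>

lemma sum_degree:
  assumes "simple_graph G" "finite X"
  shows "(\<Sum>v\<in>X. degree G v) = (\<Sum>e\<in>edges G. card (e \<inter> X))"
proof -
  have "(\<Sum>v\<in>X. degree G v) = (\<Sum>v\<in>X. \<Sum>e\<in>edges G. if v \<in> e then 1 else 0)"
    using finite_edges[OF assms(1)]
    by (simp add: degree_eq_incident[OF assms(1)] sum.If_cases Int_def)
  also have "\<dots> = (\<Sum>e\<in>edges G. \<Sum>v\<in>X. if v \<in> e then 1 else 0)"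
    by (rule sum.swap)
  also have "\<dots> = (\<Sum>e\<in>edges G. card (e \<inter> X))"
    using assms(2) by (simp add: sum.If_cases Int_def conj_commute)
  finally show ?thesis .
qed

lemma handshake:
  assumes "simple_graph G"
  shows "(\<Sum>v\<in>verts G. degree G v) = 2 * card (edges G)"
proof -
  have "card (e \<inter> verts G) = 2" if "e \<in> edges G" for e
    using assms that by (auto simp: simple_graph_def Int_absorb2)
  moreover have "finite (verts G)"
    using assms by (simp add: simple_graph_def)
  ultimately show ?thesis
    using sum_degree[OF assms] by simp
qed

text \<open>An edge that meets \<open>X\<close> contributes at least as much to the sum over
  \<open>X\<close> as to the sum over the complement. Only an edge avoiding \<open>X\<close> tips
  the balance, by 2.\<close>

lemma sum_degree_complement_le:
  assumes G: "simple_graph G" and X: "X \<subseteq> verts G"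
  shows "(\<Sum>v\<in>verts G - X. degree G v)
    \<le> (\<Sum>v\<in>X. degree G v) + 2 * card {e \<in> edges G. e \<subseteq> verts G - X}"
proof -
  have fV: "finite (verts G)" and fX: "finite X"
    using G X finite_subset by (auto simp: simple_graph_def)
  have "card (e \<inter> (verts G - X)) \<le> card (e \<inter> X) + (if e \<subseteq> verts G - X then 2 else 0)"
    if e: "e \<in> edges G" for e
  proof -
    from e G have e2: "e \<subseteq> verts G" "card e = 2" by (auto simp: simple_graph_def)
    then have fe: "finite e" using fV finite_subset by blast
    have "card e = card (e \<inter> (verts G - X)) + card (e \<inter> X)"
      using card_Int_Diff[OF fe, of X] e2(1)
      by (simp add: Int_Diff[symmetric] Int_absorb2 add.commute)
    moreover have "card (e \<inter> X) \<noteq> 0" if "\<not> e \<subseteq> verts G - X"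
      using that e2 fe by auto
    ultimately show ?thesis using e2 by (cases "e \<subseteq> verts G - X") auto
  qed
  then have "(\<Sum>e\<in>edges G. card (e \<inter> (verts G - X)))
      \<le> (\<Sum>e\<in>edges G. card (e \<inter> X) + (if e \<subseteq> verts G - X then 2 else 0))"
    by (rule sum_mono)
  also have "\<dots> = (\<Sum>e\<in>edges G. card (e \<inter> X)) + 2 * card {e \<in> edges G. e \<subseteq> verts G - X}"
    using finite_edges[OF G] by (simp add: sum.distrib sum.If_cases Int_def)
  finally show ?thesis
    using sum_degree[OF G fX] sum_degree[OF G, of "verts G - X"] fV by simp
qed

text \<open>Otherwise the first vertex of a longest path has a neighbour besides its successor; by
  maximality this neighbour lies on the path and closes a cycle.\<close>

lemma exists_degree_le_1:
  assumes G: "forest G" and ne: "verts G \<noteq> {}"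
  obtains v where "v \<in> verts G" "degree G v \<le> 1"
proof (rule ccontr)
  assume "\<not> thesis"
  with that have "\<not> degree G v \<le> 1" if "v \<in> verts G" for v
    using \<open>v \<in> verts G\<close> by blast
  then have deg: "degree G v \<ge> 2" if "v \<in> verts G" for v
    using that by fastforce
  have sG: "simple_graph G" and fV: "finite (verts G)"
    using G by (auto simp: forest_def simple_graph_def)
  define is_path where "is_path p \<longleftrightarrow> p \<noteq> [] \<and> distinct p \<and> set p \<subseteq> verts G \<and>
    (\<forall>i. Suc i < length p \<longrightarrow> {p ! i, p ! Suc i} \<in> edges G)" for p
  from ne obtain w where "w \<in> verts G" by blast
  then have "is_path [w]" by (simp add: is_path_def)
  moreover have "length p < Suc (card (verts G))" if "is_path p" for p
    using that fV card_mono[of "verts G" "set p"] distinct_card[of p]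
    by (simp add: is_path_def)
  ultimately obtain p where "is_path p" and p_max: "\<And>q. is_path q \<Longrightarrow> length q \<le> length p"
    using Lattices_Big.ex_has_greatest_nat[of is_path "[w]" length "Suc (card (verts G))"] by blast
  then have p: "p \<noteq> []" "distinct p" "set p \<subseteq> verts G"
    "\<And>i. Suc i < length p \<Longrightarrow> {p ! i, p ! Suc i} \<in> edges G"
    by (simp_all add: is_path_def)
  define x where "x = p ! 0"
  have x: "x \<in> verts G" using p by (auto simp: x_def)
  \<comment> \<open>If \<open>p\<close> has a single vertex, \<open>p ! 1\<close> is unspecified.
    This is harmless: the step only excludes one fixed value.\<close>
  have "{y. y \<in> neighbors G x \<and> y \<noteq> p ! 1} \<noteq> {}"
  proof
    assume "{y. y \<in> neighbors G x \<and> y \<noteq> p ! 1} = {}"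
    then have "neighbors G x \<subseteq> {p ! 1}" by auto
    then have "degree G x \<le> 1"
      unfolding degree_def using card_mono[of "{p ! 1}" "neighbors G x"] by simp
    with deg[OF x] show False by simp
  qed
  then obtain y where y: "{y, x} \<in> edges G" "y \<noteq> p ! 1"
    by (auto simp: neighbors_def)
  have "y \<in> set p"
  proof (rule ccontr)
    assume "y \<notin> set p"
    moreover have "y \<in> verts G" using edge_endpoints[OF sG y(1)] by simp
    moreover have "{(y # p) ! i, (y # p) ! Suc i} \<in> edges G" if "Suc i < length (y # p)" for i
      using that p y(1) by (cases i) (auto simp: x_def)
    ultimately have "is_path (y # p)" using p by (simp add: is_path_def)
    from p_max[OF this] show False by simp
  qed
  then obtain i where i: "i < length p" "y = p ! i" by (auto simp: in_set_conv_nth)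
  have "y \<noteq> x" using edge_endpoints[OF sG y(1)] by simp
  with y(2) i(2) have "i \<noteq> 0" "i \<noteq> 1" unfolding x_def by metis+
  then have i2: "2 \<le> i" by simp
  have len: "length (take (Suc i) p) = Suc i" using i by simp
  have "is_cycle G (take (Suc i) p)"
    unfolding is_cycle_def len
  proof (intro conjI allI impI)
    show "3 \<le> Suc i" using i2 by simp
    show "distinct (take (Suc i) p)" using p by simp
    fix t assume t: "t < Suc i"
    show "{take (Suc i) p ! t, take (Suc i) p ! (Suc t mod Suc i)} \<in> edges G"
    proof (cases "t = i")
      case True
      then show ?thesis using i y by (simp add: x_def)
    next
      case False
      then show ?thesis using t i p by simp
    qed
  qed
  with G show False by (auto simp: forest_def)
qed

lemma forest_subgraph:
  assumes "forest (V, E)" "W \<subseteq> V" "E' \<subseteq> E" "\<And>e. e \<in> E' \<Longrightarrow> e \<subseteq> W"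
  shows "forest (W, E')"
proof -
  have "finite W"
    using assms(1,2) finite_subset by (auto simp: forest_def simple_graph_def)
  moreover have "card e = 2" if "e \<in> E'" for e
    using assms(1,3) that by (auto simp: forest_def simple_graph_def)
  ultimately have "simple_graph (W, E')"
    using assms(4) by (simp add: simple_graph_def)
  moreover have "is_cycle (V, E) c" if "is_cycle (W, E') c" for c
    using that assms(3) by (auto simp: is_cycle_def)
  ultimately show ?thesis
    using assms(1) by (auto simp: forest_def)
qed

text \<open>Induction: deleting a vertex of degree at most 1 costs at most one edge.\<close>

lemma card_forest_edges_less:
  assumes "forest (V, E)" "V \<noteq> {}"
  shows "card E < card V"
  using assms
proof (induction "card V" arbitrary: V E rule: less_induct)
  case less
  have sG: "simple_graph (V, E)" and fV: "finite V"
    using less.prems by (auto simp: forest_def simple_graph_def)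
  have fE: "finite E" using finite_edges[OF sG] by simp
  obtain v where v: "v \<in> V" "degree (V, E) v \<le> 1"
    using exists_degree_le_1[OF less.prems(1)] less.prems(2) by auto
  let ?E' = "{e \<in> E. v \<notin> e}"
  have E: "E = ?E' \<union> {e \<in> E. v \<in> e}" by auto
  have cE: "card E \<le> card ?E' + 1"
    using v(2) fE by (subst E, subst card_Un_disjoint)
      (auto simp: degree_eq_incident[OF sG])
  have "forest (V - {v}, ?E')"
    using sG by (intro forest_subgraph[OF less.prems(1)]) (auto simp: simple_graph_def)
  show ?case
  proof (cases "V = {v}")
    case True
    have "E = {}"
    proof (rule equals0I)
      fix e assume "e \<in> E"
      with sG True have "card e = 2" "e \<subseteq> {v}"
        by (auto simp: simple_graph_def)
      then show False using card_mono[of "{v}" e] by simp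
    qed
    with True show ?thesis by simp
  next
    case False
    then have "V - {v} \<noteq> {}" using v by blast
    moreover have "card (V - {v}) < card V" using v fV by (meson card_Diff1_less)
    ultimately have "card ?E' < card (V - {v})"
      using less.hyps \<open>forest (V - {v}, ?E')\<close> by blast
    with cE v fV show ?thesis by simp
  qed
qed

section \<open>Joining components by edges\<close>

text \<open>The labelling \<open>c\<close> names the components: it is constant along edges, and by the equation
  on cardinalities it has as many values as there are components.\<close>

definition labelled_forest :: "'a ugraph \<Rightarrow> ('a \<Rightarrow> 'b) \<Rightarrow> bool" where
  "labelled_forest G c \<longleftrightarrow> forest G \<and> (\<forall>u v. {u, v} \<in> edges G \<longrightarrow> c u = c v) \<and>
     card (c ` verts G) + card (edges G) = card (verts G)"

lemma labelled_forest_empty: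
  assumes "finite V"
  shows "labelled_forest (V, {}) id"
proof -
  have "\<not> is_cycle (V, {}) p" for p
    by (cases p) (auto simp: is_cycle_def)
  with assms show ?thesis
    by (simp add: labelled_forest_def forest_def simple_graph_def)
qed

text \<open>A new cycle must use \<open>{u, v}\<close>. Its remaining edges are old and connect
  \<open>u\<close> to \<open>v\<close>, so \<open>c\<close>, being constant along them, would give
  both the same label.\<close>

lemma forest_insert_edge:
  assumes G: "forest (V, E)" and lab: "\<And>a b. {a, b} \<in> E \<Longrightarrow> c a = c b"
    and uv: "u \<in> V" "v \<in> V" "c u \<noteq> c v"
  shows "forest (V, insert {u, v} E)"
proof -
  have "u \<noteq> v" using uv by blast
  then have sG: "simple_graph (V, insert {u, v} E)"
    using G uv by (simp add: forest_def simple_graph_def)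
  have False if cyc: "is_cycle (V, insert {u, v} E) p" for p
  proof -
    define n where "n = length p"
    \<comment> \<open>The cycle is read periodically, so that a walk may start at any position
      without wrapping indices by hand.\<close>
    define q where "q t = p ! (t mod n)" for t
    have n: "n \<ge> 3" using cyc by (simp add: is_cycle_def n_def)
    have q_eq: "q s = q t \<longleftrightarrow> s mod n = t mod n" for s t
    proof -
      have "distinct p" using cyc by (simp add: is_cycle_def)
      moreover have "s mod n < length p" "t mod n < length p"
        using n unfolding n_def[symmetric] by simp_all
      ultimately show ?thesis unfolding q_def by (rule nth_eq_iff_index_eq)
    qed
    have q_edge: "{q t, q (Suc t)} \<in> insert {u, v} E" for t
    proof -
      have "{p ! (t mod n), p ! (Suc (t mod n) mod n)} \<in> insert {u, v} E"
      proof -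
        have "t mod n < length p" using n unfolding n_def[symmetric] by simp
        with cyc show ?thesis unfolding is_cycle_def n_def by simp
      qed
      then show ?thesis by (simp add: q_def mod_Suc_eq)
    qed
    have "\<exists>i<n. {q i, q (Suc i)} = {u, v}"
    proof (rule ccontr)
      assume no: "\<not> ?thesis"
      have "is_cycle (V, E) p"
        unfolding is_cycle_def
      proof (intro conjI allI impI)
        fix i assume "i < length p"
        then have "{q i, q (Suc i)} \<in> E" using q_edge[of i] no by (auto simp: n_def)
        then show "{p ! i, p ! (Suc i mod length p)} \<in> edges (V, E)"
          using \<open>i < length p\<close> by (simp add: q_def n_def)
      qed (use cyc in \<open>auto simp: is_cycle_def\<close>)
      with G show False by (auto simp: forest_def)
    qed
    then obtain i where i: "{q i, q (Suc i)} = {u, v}" by blast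
    have step: "c (q (Suc i + t)) = c (q (Suc i))" if "t < n" for t
      using that
    proof (induction t)
      case 0
      show ?case by simp
    next
      case (Suc t)
      \<comment> \<open>The new edge cannot recur within one turn: in the first case
        \<open>n\<close> would divide \<open>Suc t\<close>, which is smaller than \<open>n\<close>;
        in the second \<open>t = 0\<close>, and \<open>n\<close> would divide 2.\<close>
      have "{q (Suc i + t), q (Suc (Suc i + t))} \<noteq> {u, v}"
      proof
        assume "{q (Suc i + t), q (Suc (Suc i + t))} = {u, v}"
        with i have "(q (Suc i + t) = q i \<or> q (Suc i + t) = q (Suc i) \<and> q (Suc (Suc i + t)) = q i)"
          by (auto simp: doubleton_eq_iff)
        then show False
        proof
          assume "q (Suc i + t) = q i"
          then have "n dvd Suc i + t - i" by (metis mod_eq_dvd_iff_nat le_add1 add_Suc_shift q_eq)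
          then have "n dvd Suc t" by simp
          with Suc.prems show False by (auto dest: dvd_imp_le)
        next
          assume h: "q (Suc i + t) = q (Suc i) \<and> q (Suc (Suc i + t)) = q i"
          then have "n dvd (Suc i + t) - Suc i" by (metis mod_eq_dvd_iff_nat le_add1 q_eq)
          then have "t = 0" using Suc.prems by (auto dest: dvd_imp_le)
          with h have "n dvd Suc (Suc i) - i" by (metis mod_eq_dvd_iff_nat q_eq Suc_leD add.right_neutral le_SucI order_refl)
          with n show False by (auto dest: dvd_imp_le)
        qed
      qed
      with q_edge[of "Suc i + t"] have "c (q (Suc i + t)) = c (q (Suc (Suc i + t)))"
        using lab by blast
      with Suc show ?case by simp
    qed
    have "q (Suc i + (n - 1)) = q i" using n by (simp add: q_eq)
    with step[of "n - 1"] n have "c (q i) = c (q (Suc i))" by simp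
    with i uv show False by (auto simp: doubleton_eq_iff)
  qed
  with sG show ?thesis by (auto simp: forest_def)
qed

definition merge_labels :: "('a \<Rightarrow> 'b) \<Rightarrow> 'a \<Rightarrow> 'a \<Rightarrow> 'a \<Rightarrow> 'b" where
  "merge_labels c u v = (\<lambda>x. if c x = c v then c u else c x)"

text \<open>The label \<open>c v\<close> disappears while one edge appears, which preserves the
  equation between labels, edges and vertices.\<close>

lemma labelled_forest_insert_edge:
  assumes G: "labelled_forest (V, E) c" and uv: "u \<in> V" "v \<in> V" "c u \<noteq> c v"
  shows "labelled_forest (V, insert {u, v} E) (merge_labels c u v)"
proof -
  have lab: "c a = c b" if "{a, b} \<in> E" for a b
    using G that by (auto simp: labelled_forest_def)
  have fV: "finite V" and fE: "finite E"
    using G finite_edges[of "(V, E)"] by (auto simp: labelled_forest_def forest_def simple_graph_def)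
  have "{u, v} \<notin> E" using lab uv by blast
  moreover have "merge_labels c u v ` V = c ` V - {c v}"
    using uv by (auto simp: merge_labels_def)
  moreover have "c v \<in> c ` V" using uv by blast
  moreover have "forest (V, insert {u, v} E)"
    using G lab uv by (intro forest_insert_edge[of _ _ c]) (auto simp: labelled_forest_def)
  moreover have "card (c ` V) + card E = card V"
    using G by (simp add: labelled_forest_def)
  moreover have "card (c ` V) > 0" using fV uv by (auto simp: card_gt_0_iff)
  ultimately show ?thesis
    using lab fV fE uv
    by (auto simp: labelled_forest_def merge_labels_def doubleton_eq_iff)
qed

lemma degree_insert_edge:
  assumes "simple_graph (V, E)" "{u, v} \<notin> E" "u \<noteq> v"
  shows "degree (V, insert {u, v} E) x = degree (V, E) x + (if x = u \<or> x = v then 1 else 0)"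
proof -
  have fin: "finite (neighbors (V, E) x)" by (rule finite_neighbors[OF assms(1)])
  consider "x = u" | "x = v" | "x \<noteq> u" "x \<noteq> v" by blast
  then show ?thesis
  proof cases
    case 1
    then have "neighbors (V, insert {u, v} E) x = insert v (neighbors (V, E) x)"
      using assms(3) by (auto simp: neighbors_def doubleton_eq_iff)
    moreover have "v \<notin> neighbors (V, E) x"
      using assms(2) 1 by (simp add: neighbors_def insert_commute)
    ultimately show ?thesis using fin 1 by (simp add: degree_def)
  next
    case 2
    then have "neighbors (V, insert {u, v} E) x = insert u (neighbors (V, E) x)"
      using assms(3) by (auto simp: neighbors_def doubleton_eq_iff)
    moreover have "u \<notin> neighbors (V, E) x"
      using assms(2) 2 by (simp add: neighbors_def)
    ultimately show ?thesis using fin 2 by (simp add: degree_def)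
  next
    case 3
    then have "neighbors (V, insert {u, v} E) x = neighbors (V, E) x"
      by (auto simp: neighbors_def doubleton_eq_iff)
    with 3 show ?thesis by (simp add: degree_def)
  qed
qed

section \<open>Remaining degrees and their totals per component\<close>

text \<open>\<open>r\<close> is read as the number of edge ends that a vertex can still receive. The
  labels occurring on the \<open>support\<close> are the components that can still be
  joined.\<close>

definition support :: "'a set \<Rightarrow> ('a \<Rightarrow> nat) \<Rightarrow> 'a set" where
  "support V r = {v \<in> V. r v > 0}"

definition class_total :: "'a set \<Rightarrow> ('a \<Rightarrow> 'b) \<Rightarrow> ('a \<Rightarrow> nat) \<Rightarrow> 'a \<Rightarrow> nat" where
  "class_total V c r u = (\<Sum>v | v \<in> V \<and> c v = c u. r v)"

text \<open>Accounts for a new edge \<open>{u, v}\<close>. The subtraction is truncated, but the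
  constructions only join vertices of the \<open>support\<close>.\<close>

definition consume :: "('a \<Rightarrow> nat) \<Rightarrow> 'a \<Rightarrow> 'a \<Rightarrow> 'a \<Rightarrow> nat" where
  "consume r u v = r(u := r u - 1, v := r v - 1)"

lemma class_total_pos:
  assumes "finite V" "u \<in> support V r"
  shows "class_total V c r u > 0"
proof -
  have "r u \<le> class_total V c r u"
    unfolding class_total_def using assms by (intro member_le_sum) (auto simp: support_def)
  with assms show ?thesis by (simp add: support_def)
qed

lemma sum_support: "finite V \<Longrightarrow> (\<Sum>v\<in>support V r. r v) = (\<Sum>v\<in>V. r v)"
  by (rule sum.mono_neutral_left) (auto simp: support_def)

text \<open>\<open>class_total\<close> is indexed by vertices, so summing it directly could count a
  class several times; \<open>s\<close> is the same quantity indexed by labels.\<close>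

lemma sum_class_totals:
  assumes "finite V"
  obtains s where "\<And>u. u \<in> support V r \<Longrightarrow> s (c u) = class_total V c r u"
    "(\<Sum>v\<in>V. r v) = (\<Sum>x\<in>c ` support V r. s x)"
proof
  let ?s = "\<lambda>x. \<Sum>v | v \<in> V \<and> c v = x. r v"
  show "?s (c u) = class_total V c r u" for u by (simp add: class_total_def)
  have fin: "finite (support V r)" using assms by (simp add: support_def)
  have "(\<Sum>v\<in>V. r v) = (\<Sum>v\<in>support V r. r v)" using sum_support[OF assms] by simp
  also have "\<dots> = (\<Sum>x\<in>c ` support V r. \<Sum>v | v \<in> support V r \<and> c v = x. r v)"
    by (rule sum.image_gen[OF fin])
  also have "\<dots> = (\<Sum>x\<in>c ` support V r. ?s x)"
    using assms by (intro sum.cong refl sum.mono_neutral_left) (auto simp: support_def)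
  finally show "(\<Sum>v\<in>V. r v) = (\<Sum>x\<in>c ` support V r. ?s x)" .
qed

text \<open>Averaging: if every class with units left had at least two, the total would be at least
  twice the number of classes.\<close>

lemma ex_class_total_1:
  assumes "finite V" "(\<Sum>v\<in>V. r v) < 2 * card (c ` support V r)"
  obtains u where "u \<in> support V r" "class_total V c r u = 1"
proof (rule ccontr)
  assume "\<not> thesis"
  with that have no1: "class_total V c r u \<noteq> 1" if "u \<in> support V r" for u
    using that by blast
  have ge2: "class_total V c r u \<ge> 2" if "u \<in> support V r" for u
    using no1[OF that] class_total_pos[OF assms(1) that, of c] by simp
  obtain s where s: "\<And>u. u \<in> support V r \<Longrightarrow> s (c u) = class_total V c r u"
    "(\<Sum>v\<in>V. r v) = (\<Sum>x\<in>c ` support V r. s x)"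
    using sum_class_totals[OF assms(1)] by blast
  have "(\<Sum>x\<in>c ` support V r. 2) \<le> (\<Sum>x\<in>c ` support V r. s x)"
    using s(1) ge2 by (intro sum_mono) auto
  with s(2) assms(2) show False by simp
qed

lemma sum_eq_card_classes:
  assumes "finite V" "\<And>u. u \<in> support V r \<Longrightarrow> class_total V c r u = 1"
  shows "(\<Sum>v\<in>V. r v) = card (c ` support V r)"
proof -
  obtain s where s: "\<And>u. u \<in> support V r \<Longrightarrow> s (c u) = class_total V c r u"
    "(\<Sum>v\<in>V. r v) = (\<Sum>x\<in>c ` support V r. s x)"
    using sum_class_totals[OF assms(1)] by blast
  have "(\<Sum>x\<in>c ` support V r. s x) = (\<Sum>x\<in>c ` support V r. 1)"
    using s(1) assms(2) by (intro sum.cong) auto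
  with s(2) show ?thesis by simp
qed

text \<open>Two distinct vertices with units left would bring their class to a total of at least
  2.\<close>

lemma eq_if_class_total_1:
  assumes "finite V" "class_total V c r u = 1" "u \<in> support V r" "w \<in> support V r" "c u = c w"
  shows "u = w"
proof (rule ccontr)
  assume "u \<noteq> w"
  have "(\<Sum>v\<in>{u, w}. r v) \<le> class_total V c r u"
    unfolding class_total_def using assms by (intro sum_mono2) (auto simp: support_def)
  with \<open>u \<noteq> w\<close> assms show False by (auto simp: support_def)
qed

lemma sum_consume:
  assumes "finite X" "u \<noteq> v" "r u > 0" "r v > 0"
  shows "(\<Sum>x\<in>X. r x)
    = (\<Sum>x\<in>X. consume r u v x) + (if u \<in> X then 1 else 0) + (if v \<in> X then 1 else 0)"
proof -
  have "(\<Sum>x\<in>X. r x)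
      = (\<Sum>x\<in>X. consume r u v x + (if x = u then 1 else 0) + (if x = v then 1 else 0))"
    using assms by (intro sum.cong) (auto simp: consume_def)
  also have "\<dots> = (\<Sum>x\<in>X. consume r u v x) + (if u \<in> X then 1 else 0) + (if v \<in> X then 1 else 0)"
    using assms(1) by (simp add: sum.distrib)
  finally show ?thesis .
qed

text \<open>Only \<open>c u\<close> and \<open>c v\<close> can vanish: every other class keeps its
  label and its units.\<close>

lemma card_classes_consume:
  assumes fV: "finite V" and "c u \<noteq> c v"
  shows "card (c ` support V r)
    \<le> card (merge_labels c u v ` support V (consume r u v)) + 2"
proof -
  have fin: "finite (support V r)" for r :: "'a \<Rightarrow> nat" using fV by (simp add: support_def)
  have "c ` support V r \<subseteq> merge_labels c u v ` support V (consume r u v) \<union> {c u, c v}"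
  proof
    fix y assume "y \<in> c ` support V r"
    then obtain x where x: "x \<in> V" "r x > 0" "y = c x" by (auto simp: support_def)
    show "y \<in> merge_labels c u v ` support V (consume r u v) \<union> {c u, c v}"
    proof (cases "y = c u \<or> y = c v")
      case False
      then have "x \<in> support V (consume r u v)" "merge_labels c u v x = y"
        using x by (auto simp: support_def consume_def merge_labels_def)
      then show ?thesis by blast
    qed auto
  qed
  then have "card (c ` support V r)
      \<le> card (merge_labels c u v ` support V (consume r u v) \<union> {c u, c v})"
    using fin by (intro card_mono) auto
  also have "\<dots> \<le> card (merge_labels c u v ` support V (consume r u v)) + card {c u, c v}"
    by (rule card_Un_le)
  also have "card {c u, c v} \<le> 2" by (simp add: card_insert_if)
  finally show ?thesis by simp
qed

text \<open>A class with two units keeps one after the edge is drawn, so the merged component stays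
  available under the label \<open>c u\<close> and only \<open>c v\<close> is lost.\<close>

lemma card_classes_consume_big:
  assumes fV: "finite V" and uv: "c u \<noteq> c v"
    and supp: "u \<in> support V r" "v \<in> support V r"
    and big: "class_total V c r u \<ge> 2 \<or> class_total V c r v \<ge> 2"
  shows "card (c ` support V r)
    \<le> card (merge_labels c u v ` support V (consume r u v)) + 1"
proof -
  have fin: "finite (support V r)" for r :: "'a \<Rightarrow> nat" using fV by (simp add: support_def)
  have pos: "r u > 0" "r v > 0" "u \<in> V" "v \<in> V" "u \<noteq> v"
    using supp uv by (auto simp: support_def)
  \<comment> \<open>Since \<open>u\<close> and \<open>v\<close> lie in different classes, each class
    loses at most one unit.\<close>
  have "\<exists>w\<in>support V (consume r u v). c w = c z" if z: "z = u \<or> z = v" "class_total V c r z \<ge> 2" for z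
  proof (rule ccontr)
    assume no: "\<not> ?thesis"
    let ?X = "{x. x \<in> V \<and> c x = c z}"
    have "(\<Sum>x\<in>?X. consume r u v x) = 0"
      using no by (intro sum.neutral) (auto simp: support_def)
    moreover have "(\<Sum>x\<in>?X. r x) = (\<Sum>x\<in>?X. consume r u v x)
        + (if u \<in> ?X then 1 else 0) + (if v \<in> ?X then 1 else 0)"
      using fV pos by (intro sum_consume) auto
    moreover have "\<not> (u \<in> ?X \<and> v \<in> ?X)" using uv by auto
    ultimately have "(\<Sum>x\<in>?X. r x) \<le> 1" by (auto split: if_splits)
    with z(2) show False by (simp add: class_total_def)
  qed
  with big obtain w where w: "w \<in> support V (consume r u v)" "c w = c u \<or> c w = c v" by metis
  then have cu: "c u \<in> merge_labels c u v ` support V (consume r u v)"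
    by (auto simp: merge_labels_def image_iff intro!: bexI[of _ w])
  have "c ` support V r \<subseteq> insert (c v) (merge_labels c u v ` support V (consume r u v))"
  proof
    fix y assume "y \<in> c ` support V r"
    then obtain x where x: "x \<in> V" "r x > 0" "y = c x" by (auto simp: support_def)
    show "y \<in> insert (c v) (merge_labels c u v ` support V (consume r u v))"
    proof (cases "y = c u \<or> y = c v")
      case True
      with cu show ?thesis by auto
    next
      case False
      then have "x \<in> support V (consume r u v)" "merge_labels c u v x = y"
        using x by (auto simp: support_def consume_def merge_labels_def)
      then show ?thesis by blast
    qed
  qed
  then have "card (c ` support V r)
      \<le> card (insert (c v) (merge_labels c u v ` support V (consume r u v)))"
    using fin by (intro card_mono) auto
  also have "\<dots> \<le> card (merge_labels c u v ` support V (consume r u v)) + 1"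
    by (simp add: card_insert_le_m1 card_insert_if fin)
  finally show ?thesis .
qed

section \<open>Greedy construction of forests\<close>

lemma labelled_forest_simps:
  assumes "labelled_forest (V, E) c"
  shows "simple_graph (V, E)" "finite V" "finite E" "{u, v} \<in> E \<Longrightarrow> c u = c v"
    "card (c ` V) + card E = card V"
  using assms finite_edges[of "(V, E)"]
  by (auto simp: labelled_forest_def forest_def simple_graph_def)

lemma degree_insert_consume:
  assumes lf: "labelled_forest (V, E) c" and supp: "u \<in> support V r" "v \<in> support V r"
    and "c u \<noteq> c v"
  shows "degree (V, insert {u, v} E) x + consume r u v x = degree (V, E) x + r x"
proof -
  have "u \<noteq> v" "{u, v} \<notin> E" using assms labelled_forest_simps(4)[OF lf] by auto
  with degree_insert_edge[OF labelled_forest_simps(1)[OF lf] this(2,1), of x] supp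
  show ?thesis by (auto simp: consume_def support_def)
qed

text \<open>Induction on the edges still to be drawn, which must stay fewer than the available
  components. Starting each edge in a class with two or more units loses one component per edge;
  without such a class, components abound.\<close>

lemma ex_edges_within_capacity:
  fixes c :: "'a \<Rightarrow> 'b"
  assumes "labelled_forest (V, E) c" "2 * j \<le> (\<Sum>v\<in>V. r v)"
    and "j = 0 \<or> j + 1 \<le> card (c ` support V r)"
  shows "\<exists>E' (c' :: 'a \<Rightarrow> 'b). labelled_forest (V, E') c' \<and> card E' = card E + j \<and>
    (\<forall>x. degree (V, E') x \<le> degree (V, E) x + r x) \<and> (\<forall>e\<in>E' - E. e \<subseteq> support V r)"
  using assms
proof (induction j arbitrary: E c r)
  case 0
  then show ?case by (intro exI[of _ E] exI[of _ c]) auto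
next
  case (Suc j)
  note lf = Suc.prems(1)
  note fV = labelled_forest_simps(2)[OF lf]
  have classes: "Suc j + 1 \<le> card (c ` support V r)" using Suc.prems(3) by simp
  have other: "\<exists>v\<in>support V r. c v \<noteq> c u" for u
  proof (rule ccontr)
    assume "\<not> ?thesis"
    then have "card (c ` support V r) \<le> card {c u}" by (intro card_mono) auto
    with classes show False by simp
  qed
  obtain u v where uv: "u \<in> support V r" "v \<in> support V r" "c u \<noteq> c v"
    and classes': "j = 0 \<or> j + 1 \<le> card (merge_labels c u v ` support V (consume r u v))"
  proof (cases "\<exists>u\<in>support V r. class_total V c r u \<ge> 2")
    case True
    then obtain u where u: "u \<in> support V r" "class_total V c r u \<ge> 2" by blast
    obtain v where v: "v \<in> support V r" "c u \<noteq> c v" using other[of u] by metis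
    show thesis
      using card_classes_consume_big[of V c u v r] fV u v classes by (intro that[of u v]) auto
  next
    case False
    have "class_total V c r u = 1" if "u \<in> support V r" for u
      using False that class_total_pos[OF fV that, of c] by fastforce
    \<comment> \<open>With single units only, there are as many classes as units, at least
      \<open>2 * j + 2\<close>. Losing two leaves \<open>2 * j\<close>, which is at least
      \<open>j + 1\<close> unless \<open>j = 0\<close>.\<close>
    then have "2 * Suc j \<le> card (c ` support V r)"
      using sum_eq_card_classes[OF fV, of r c] Suc.prems(2) by simp
    moreover have "support V r \<noteq> {}" using classes by auto
    then obtain u where u: "u \<in> support V r" by blast
    moreover obtain v where v: "v \<in> support V r" "c u \<noteq> c v" using other[of u] by metis
    ultimately show thesis
      using card_classes_consume[of V c u v r] fV by (intro that[of u v]) auto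
  qed
  let ?r = "consume r u v" and ?E = "insert {u, v} E" and ?c = "merge_labels c u v"
  have uv': "u \<in> V" "v \<in> V" "u \<noteq> v" "r u > 0" "r v > 0" using uv by (auto simp: support_def)
  have lf': "labelled_forest (V, ?E) ?c"
    using labelled_forest_insert_edge[OF lf] uv uv' by blast
  have "2 * j \<le> (\<Sum>x\<in>V. ?r x)"
    using sum_consume[of V u v r] fV uv' Suc.prems(2) by simp
  from Suc.IH[OF lf' this classes'] obtain E' and c' :: "'a \<Rightarrow> 'b" where E':
    "labelled_forest (V, E') c'" "card E' = card ?E + j"
    "\<forall>x. degree (V, E') x \<le> degree (V, ?E) x + ?r x"
    "\<forall>e\<in>E' - ?E. e \<subseteq> support V ?r" by blast
  have "card ?E = card E + 1"
    using labelled_forest_simps(3)[OF lf] labelled_forest_simps(4)[OF lf, of u v] uv(3)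
    by (auto simp: card_insert_if)
  then have "card E' = card E + Suc j" using E'(2) by simp
  moreover have "degree (V, E') x \<le> degree (V, E) x + r x" for x
    using spec[OF E'(3), of x] degree_insert_consume[OF lf uv, of x] by simp
  moreover have "support V ?r \<subseteq> support V r"
    by (auto simp: support_def consume_def split: if_splits)
  then have "e \<subseteq> support V r" if "e \<in> E' - E" for e
    using E'(4) that uv by blast
  ultimately show ?case using E'(1) by blast
qed

text \<open>A heavy class reached in \<open>B\<close> is joined to \<open>a0\<close>, and one
  reached only in \<open>A\<close> to \<open>b0\<close>; the classes differ because their totals do.
  If all totals are 1, any two vertices of the \<open>support\<close> lie in different
  classes.\<close>

lemma ex_crossing_pair:
  assumes fV: "finite V" and "A \<inter> B = {}" and V: "V = A \<union> B"
    and a0: "a0 \<in> A" "a0 \<in> support V r" "class_total V c r a0 = 1"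
    and b0: "b0 \<in> B" "b0 \<in> support V r"
  shows "\<exists>a\<in>A. \<exists>b\<in>B. a \<in> support V r \<and> b \<in> support V r \<and> c a \<noteq> c b \<and>
    (class_total V c r a \<ge> 2 \<or> class_total V c r b \<ge> 2 \<or>
     (\<forall>w\<in>support V r. class_total V c r w = 1))"
proof -
  have tot_cong: "c x = c y \<Longrightarrow> class_total V c r x = class_total V c r y" for x y
    by (simp add: class_total_def)
  have pos: "w \<in> support V r \<Longrightarrow> class_total V c r w = 1 \<or> class_total V c r w \<ge> 2" for w
    using class_total_pos[OF fV, of w r c] by fastforce
  consider (B) b where "b \<in> B" "b \<in> support V r" "class_total V c r b \<ge> 2"
    | (A) a where "a \<in> A" "a \<in> support V r" "class_total V c r a \<ge> 2" "class_total V c r b0 = 1"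
    | (none) "\<forall>w\<in>support V r. class_total V c r w = 1"
  proof (cases "\<exists>w\<in>support V r. class_total V c r w \<noteq> 1")
    case True
    then obtain w where w: "w \<in> support V r" "class_total V c r w \<ge> 2" using pos by blast
    then have "w \<in> A \<or> w \<in> B" using V by (auto simp: support_def)
    with w show thesis using A B pos[OF b0(2)] b0(1,2) by blast
  qed blast
  then show ?thesis
  proof cases
    case (B b)
    then have "c a0 \<noteq> c b" using a0(3) tot_cong[of a0 b] by auto
    with B a0 show ?thesis by blast
  next
    case (A a)
    then have "c a \<noteq> c b0" using tot_cong[of a b0] by auto
    with A b0 show ?thesis by blast
  next
    case none
    have "c a0 \<noteq> c b0"
      using eq_if_class_total_1[OF fV a0(3,2) b0(2)] assms(2) a0(1) b0(1) by blast
    with none a0 b0 show ?thesis by blast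
  qed
qed

text \<open>Induction on the \<open>n\<close> crossing edges still to be drawn, with more than
  \<open>n\<close> components kept available. As all these edges cross, every vertex of
  \<open>B\<close> with a unit left acquires a neighbour in \<open>A\<close>.\<close>

lemma ex_bipartite_edges:
  fixes c :: "'a \<Rightarrow> 'b"
  assumes "labelled_forest (V, E) c" "A \<inter> B = {}" "V = A \<union> B"
    and "(\<Sum>v\<in>A. r v) = n" "(\<Sum>v\<in>B. r v) = n"
    and "n = 0 \<or> n + 1 \<le> card (c ` support V r)"
  shows "\<exists>E' (c' :: 'a \<Rightarrow> 'b). labelled_forest (V, E') c' \<and> E \<subseteq> E' \<and>
    (\<forall>x\<in>V. degree (V, E') x = degree (V, E) x + r x) \<and>
    (\<forall>b\<in>B. r b > 0 \<longrightarrow> (\<exists>a\<in>A. {a, b} \<in> E'))"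
  using assms
proof (induction n arbitrary: E c r)
  case 0
  then have "finite V" by (auto simp: labelled_forest_def forest_def simple_graph_def)
  with 0 have "r x = 0" if "x \<in> V" for x using that by auto
  with 0 show ?case by (intro exI[of _ E] exI[of _ c]) auto
next
  case (Suc n)
  note lf = Suc.prems(1) and disj = Suc.prems(2) and V = Suc.prems(3)
  note fV = labelled_forest_simps(2)[OF lf]
  have fin: "finite A" "finite B" using fV V by auto
  have classes: "Suc n + 1 \<le> card (c ` support V r)" using Suc.prems(6) by simp
  have sumV: "(\<Sum>v\<in>V. r v) = 2 * Suc n"
    using Suc.prems(4,5) fin disj V by (simp add: sum.union_disjoint)
  \<comment> \<open>There are \<open>2 * Suc n\<close> units for at least \<open>Suc n + 1\<close>
    classes, so some class has a single unit.\<close>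
  have "(\<Sum>v\<in>V. r v) < 2 * card (c ` support V r)" using sumV classes by simp
  then obtain w where w: "w \<in> support V r" "class_total V c r w = 1"
    using ex_class_total_1[OF fV] by blast
  have "\<exists>x\<in>X. r x > 0" if "(\<Sum>v\<in>X. r v) = Suc n" for X
    using that by (metis sum.neutral gr0I nat.distinct(1))
  with Suc.prems(4,5) obtain a0 b0 where ab0: "a0 \<in> A" "r a0 > 0" "b0 \<in> B" "r b0 > 0" by metis
  then have supp0: "a0 \<in> support V r" "b0 \<in> support V r" using V by (auto simp: support_def)
  have "\<exists>u\<in>A. \<exists>v\<in>B. u \<in> support V r \<and> v \<in> support V r \<and> c u \<noteq> c v \<and>
    (class_total V c r u \<ge> 2 \<or> class_total V c r v \<ge> 2 \<or>
     (\<forall>w\<in>support V r. class_total V c r w = 1))"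
  proof (cases "w \<in> A")
    case True
    then show ?thesis using ex_crossing_pair[OF fV disj V] w ab0 supp0 by blast
  next
    case False
    then have "w \<in> B" using w V by (auto simp: support_def)
    \<comment> \<open>The single unit lies in \<open>B\<close>, so \<open>A\<close> and
      \<open>B\<close> exchange roles.\<close>
    then have "\<exists>v\<in>B. \<exists>u\<in>A. v \<in> support V r \<and> u \<in> support V r \<and> c v \<noteq> c u \<and>
      (class_total V c r v \<ge> 2 \<or> class_total V c r u \<ge> 2 \<or>
       (\<forall>w\<in>support V r. class_total V c r w = 1))"
      using ex_crossing_pair[OF fV _ _ _ w(1,2), of B A a0] disj V ab0 supp0 by blast
    then show ?thesis by metis
  qed
  then obtain u v where uvAB: "u \<in> A" "v \<in> B"
    and uv: "u \<in> support V r" "v \<in> support V r" "c u \<noteq> c v"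
    and big: "class_total V c r u \<ge> 2 \<or> class_total V c r v \<ge> 2 \<or>
     (\<forall>w\<in>support V r. class_total V c r w = 1)" by blast
  let ?r = "consume r u v" and ?E = "insert {u, v} E" and ?c = "merge_labels c u v"
  \<comment> \<open>If all totals are 1, there are \<open>2 * Suc n\<close> classes and losing two
    is affordable; otherwise the chosen pair loses only one.\<close>
  have classes': "n = 0 \<or> n + 1 \<le> card (?c ` support V ?r)"
  proof (cases "\<forall>w\<in>support V r. class_total V c r w = 1")
    case True
    then have "2 * Suc n = card (c ` support V r)"
      using sum_eq_card_classes[OF fV, of r c] sumV by simp
    then show ?thesis using card_classes_consume[OF fV uv(3), of r] by (cases n) auto
  next
    case False
    with big have "class_total V c r u \<ge> 2 \<or> class_total V c r v \<ge> 2" by blast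
    then show ?thesis using card_classes_consume_big[OF fV uv(3,1,2)] classes by (cases n) auto
  qed
  have uv': "u \<in> V" "v \<in> V" "u \<noteq> v" "r u > 0" "r v > 0" using uv by (auto simp: support_def)
  have lf': "labelled_forest (V, ?E) ?c"
    using labelled_forest_insert_edge[OF lf] uv uv' by blast
  have "u \<notin> B" "v \<notin> A" using uvAB disj by auto
  then have sums: "(\<Sum>x\<in>A. ?r x) = n" "(\<Sum>x\<in>B. ?r x) = n"
    using sum_consume[of A u v r] sum_consume[of B u v r] fin uv' uvAB Suc.prems(4,5) by simp_all
  from Suc.IH[OF lf' disj V sums classes'] obtain E' and c' :: "'a \<Rightarrow> 'b" where E':
    "labelled_forest (V, E') c'" "?E \<subseteq> E'"
    "\<forall>x\<in>V. degree (V, E') x = degree (V, ?E) x + ?r x"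
    "\<forall>b\<in>B. ?r b > 0 \<longrightarrow> (\<exists>a\<in>A. {a, b} \<in> E')" by blast
  have "degree (V, E') x = degree (V, E) x + r x" if "x \<in> V" for x
    using bspec[OF E'(3) that] degree_insert_consume[OF lf uv, of x] by simp
  moreover have "\<exists>a\<in>A. {a, b} \<in> E'" if "b \<in> B" "r b > 0" for b
  proof (cases "b = v")
    case True
    then show ?thesis using E'(2) uvAB by blast
  next
    case False
    then show ?thesis using bspec[OF E'(4) that(1)] that \<open>u \<notin> B\<close> by (auto simp: consume_def split: if_splits)
  qed
  ultimately show ?case using E'(1,2) by blast
qed

text \<open>\<open>W\<close> is the heavier side and \<open>2 * j\<close> its excess. Drawing
  \<open>j\<close> edges inside \<open>W\<close> balances the sides; crossing edges then use up the
  rest.\<close>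

lemma ex_forest_dominated:
  fixes V :: "'a set"
  assumes fV: "finite V" and disj: "A \<inter> B = {}" and V: "V = A \<union> B" and W: "W = A \<or> W = B"
    and pos: "\<And>v. v \<in> V \<Longrightarrow> d v > 0"
    and balance: "(\<Sum>v\<in>W. d v) = (\<Sum>v\<in>V - W. d v) + 2 * j"
    and few: "(\<Sum>v\<in>V. d v) + 2 \<le> 2 * card V"
    and cap: "2 * j \<le> (\<Sum>v\<in>W. d v - 1)"
    and classes: "j = 0 \<or> j + 1 \<le> card {v \<in> W. d v \<ge> 2}"
  shows "\<exists>E. forest (V, E) \<and> (\<forall>v\<in>V. degree (V, E) v = d v) \<and> dominating_set (V, E) A"
proof -
  have WV: "W \<subseteq> V" using W V by blast
  \<comment> \<open>One unit per vertex of \<open>W\<close> is held back for a crossing edge; this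
    keeps all remaining degrees positive and makes \<open>A\<close> dominating.\<close>
  define r where "r v = (if v \<in> W then d v - 1 else 0)" for v
  have supp: "support V r = {v \<in> W. d v \<ge> 2}" using WV by (auto simp: support_def r_def)
  have "(\<Sum>v\<in>V. r v) = (\<Sum>v\<in>W. r v)"
    using fV WV by (intro sum.mono_neutral_right) (auto simp: r_def)
  also have "\<dots> = (\<Sum>v\<in>W. d v - 1)" by (simp add: r_def)
  finally have cap': "2 * j \<le> (\<Sum>v\<in>V. r v)" using cap by simp
  have classes': "j = 0 \<or> j + 1 \<le> card (id ` support V r)" using classes supp by simp
  from ex_edges_within_capacity[OF labelled_forest_empty[OF fV] cap' classes'] obtain H and c :: "'a \<Rightarrow> 'a" where H: "labelled_forest (V, H) c" "card H = card ({} :: 'a set set) + j"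
    "\<forall>x. degree (V, H) x \<le> degree (V, {}) x + r x" "\<forall>e\<in>H - {}. e \<subseteq> support V r"
    by blast
  have deg_le: "degree (V, H) x \<le> r x" for x
    using spec[OF H(3), of x] by (simp add: degree_def neighbors_def)
  define s where "s v = d v - degree (V, H) v" for v
  have deg_less: "degree (V, H) v < d v" if "v \<in> V" for v
    using deg_le[of v] pos[OF that] by (auto simp: r_def split: if_splits)
  then have s_pos: "s v > 0" if "v \<in> V" for v using that by (simp add: s_def)
  have sum_s: "(\<Sum>v\<in>X. d v) = (\<Sum>v\<in>X. s v) + (\<Sum>v\<in>X. degree (V, H) v)" if "X \<subseteq> V" for X
    unfolding sum.distrib[symmetric] using that deg_less by (intro sum.cong) (auto simp: s_def less_imp_le)
  have degVW: "(\<Sum>v\<in>V - W. degree (V, H) v) = 0"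
    using deg_le by (intro sum.neutral) (auto simp: r_def, metis le_zero_eq)
  have sumVW: "(\<Sum>v\<in>V. f v) = (\<Sum>v\<in>W. f v) + (\<Sum>v\<in>V - W. f v)" for f :: "'a \<Rightarrow> nat"
    using sum.subset_diff[OF WV fV, of f] by simp
  have "(\<Sum>v\<in>V. degree (V, H) v) = 2 * j"
    using handshake[OF labelled_forest_simps(1)[OF H(1)]] H(2) by simp
  then have degW: "(\<Sum>v\<in>W. degree (V, H) v) = 2 * j" using sumVW degVW by simp
  define n where "n = (\<Sum>v\<in>V - W. d v)"
  have "(\<Sum>v\<in>W. s v) = n" "(\<Sum>v\<in>V - W. s v) = n"
    using sum_s[OF WV] sum_s[of "V - W"] degW degVW balance by (simp_all add: n_def)
  moreover have "W = A \<and> V - W = B \<or> W = B \<and> V - W = A" using W V disj by blast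
  ultimately have sums: "(\<Sum>v\<in>A. s v) = n" "(\<Sum>v\<in>B. s v) = n" by auto
  have "support V s = V" using s_pos by (auto simp: support_def)
  moreover have "card (c ` V) + j = card V"
    using labelled_forest_simps(5)[OF H(1)] H(2) by simp
  \<comment> \<open>The total degree is \<open>2 * n + 2 * j\<close>, and \<open>card V - j\<close>
    components are left, all with units. So \<open>few\<close> says that they outnumber the
    \<open>n\<close> crossing edges.\<close>
  moreover have "2 * n + 2 * j + 2 \<le> 2 * card V"
    using few sumVW[of d] balance by (simp add: n_def)
  ultimately have "n = 0 \<or> n + 1 \<le> card (c ` support V s)" by simp
  from ex_bipartite_edges[OF H(1) disj V sums this] obtain E and c' :: "'a \<Rightarrow> 'a" where E:
    "labelled_forest (V, E) c'" "H \<subseteq> E" "\<forall>x\<in>V. degree (V, E) x = degree (V, H) x + s x"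
    "\<forall>b\<in>B. s b > 0 \<longrightarrow> (\<exists>a\<in>A. {a, b} \<in> E)" by blast
  have "degree (V, E) x = d x" if "x \<in> V" for x
    using bspec[OF E(3) that] deg_less[OF that] by (simp add: s_def)
  moreover have "dominating_set (V, E) A"
    using E(4) s_pos V by (auto simp: dominating_set_def neighbors_def)
  ultimately show ?thesis using E(1) by (auto simp: labelled_forest_def)
qed

section \<open>Domination and degree sequences\<close>

lemma domination_number_le:
  assumes "simple_graph G" "dominating_set G D"
  shows "domination_number G \<le> card D"
proof -
  have "{card D | D. dominating_set G D} \<subseteq> {..card (verts G)}"
    using assms(1) by (auto simp: dominating_set_def simple_graph_def intro: card_mono)
  then have "finite {card D | D. dominating_set G D}" by (rule finite_subset) simp
  then show ?thesis unfolding domination_number_def using assms(2) by (intro Min_le) auto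
qed

lemma domination_number_attained:
  assumes "simple_graph G"
  obtains D where "dominating_set G D" "card D = domination_number G"
proof -
  have "{card D | D. dominating_set G D} \<subseteq> {..card (verts G)}"
    using assms by (auto simp: dominating_set_def simple_graph_def intro: card_mono)
  then have "finite {card D | D. dominating_set G D}" by (rule finite_subset) simp
  moreover have "dominating_set G (verts G)" by (simp add: dominating_set_def)
  then have "{card D | D. dominating_set G D} \<noteq> {}" by blast
  ultimately have "domination_number G \<in> {card D | D. dominating_set G D}"
    unfolding domination_number_def by (rule Min_in)
  then show thesis using that by auto
qed

lemma card_le_sum_degree_dominating:
  assumes G: "simple_graph G" and D: "dominating_set G D"
  shows "card (verts G - D) \<le> (\<Sum>v\<in>D. degree G v)"
proof -
  have fD: "finite D"
    using G D finite_subset by (auto simp: simple_graph_def dominating_set_def)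
  have "verts G - D \<subseteq> (\<Union>v\<in>D. neighbors G v)"
    using D by (fastforce simp: dominating_set_def neighbors_def insert_commute)
  then have "card (verts G - D) \<le> card (\<Union>v\<in>D. neighbors G v)"
    using fD finite_neighbors[OF G] by (intro card_mono) auto
  also have "\<dots> \<le> (\<Sum>v\<in>D. card (neighbors G v))" by (rule card_UN_le[OF fD])
  finally show ?thesis by (simp add: degree_def)
qed

text \<open>The degree sequence is fixed only as a multiset; the enumeration turns sums over
  vertices into sums over list positions.\<close>

lemma degree_sequence_enumeration:
  assumes "has_degree_sequence G d" "finite (verts G)"
  obtains h where "bij_betw h {..<length d} (verts G)"
    "\<And>i. i < length d \<Longrightarrow> degree G (h i) = d ! i"
proof -
  obtain xs where set: "set xs = verts G" and dist: "distinct xs"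
    using finite_distinct_list[OF assms(2)] by blast
  then have xs: "mset xs = mset_set (verts G)" using mset_set_set by metis
  have "mset d = mset (map (degree G) xs)"
    using assms(1) xs by (simp add: has_degree_sequence_def)
  then obtain f where f: "bij_betw f {..<length d} {..<length (map (degree G) xs)}"
    "\<forall>i<length d. d ! i = map (degree G) xs ! f i"
    using permutation_Ex_bij by blast
  have "bij_betw ((!) xs \<circ> f) {..<length d} (verts G)"
    using f(1) bij_betw_nth[OF dist refl set[symmetric]] by (intro bij_betw_trans) simp_all
  moreover have "degree G (((!) xs \<circ> f) i) = d ! i" if "i < length d" for i
  proof -
    have "f i < length xs" using bij_betwE[OF f(1)] that by simp
    with f(2) that show ?thesis by simp
  qed
  ultimately show thesis by (rule that)
qed

text \<open>Exchange argument: \<open>I - ?K\<close> and \<open>?K - I\<close> have equal size, and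
  \<open>d ! k\<close> separates their entries.\<close>

lemma sum_nth_le_prefix:
  fixes d :: "nat list"
  assumes sorted: "sorted_wrt (\<ge>) d" and I: "I \<subseteq> {..<length d}"
  shows "(\<Sum>i\<in>I. d ! i) \<le> (\<Sum>i = 0..<card I. d ! i)"
proof -
  define k where "k = card I"
  let ?K = "{0..<k}"
  have fI: "finite I" using I finite_subset by blast
  have anti: "d ! j \<le> d ! i" if "i \<le> j" "j < length d" for i j
    using sorted_wrt_nth_less[OF sorted, of i j] that by (cases "i = j") auto
  have cards: "card (I - ?K) = card (?K - I)"
    using card_Int_Diff[OF fI, of ?K] card_Int_Diff[of ?K I]
    by (simp add: Int_commute k_def)
  have "d ! i \<le> d ! k" if "i \<in> I - ?K" for i
    using anti[of k i] I that by auto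
  then have "(\<Sum>i\<in>I - ?K. d ! i) \<le> card (I - ?K) * d ! k"
    using sum_bounded_above[of "I - ?K" "(!) d" "d ! k"] by simp
  also have "\<dots> \<le> (\<Sum>i\<in>?K - I. d ! i)"
  proof (cases "k < length d")
    case True
    then have "d ! k \<le> d ! i" if "i \<in> ?K - I" for i
      using anti[of i k] that by simp
    then show ?thesis
      using sum_bounded_below[of "?K - I" "d ! k" "(!) d"] cards by simp
  next
    case False
    \<comment> \<open>Here \<open>d ! k\<close> is outside the list, but it is multiplied by
      0.\<close>
    then have "I - ?K = {}" using I by auto
    then have "card (I - ?K) = 0" by (simp only: card.empty)
    then show ?thesis by simp
  qed
  finally have "(\<Sum>i\<in>I - ?K. d ! i) \<le> (\<Sum>i\<in>?K - I. d ! i)" .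
  moreover have "(\<Sum>i\<in>I. d ! i) = (\<Sum>i\<in>I \<inter> ?K. d ! i) + (\<Sum>i\<in>I - ?K. d ! i)"
    by (rule sum.Int_Diff[OF fI])
  moreover have "(\<Sum>i\<in>?K. d ! i) = (\<Sum>i\<in>I \<inter> ?K. d ! i) + (\<Sum>i\<in>?K - I. d ! i)"
    using sum.Int_Diff[of ?K "\<lambda>i. d ! i" I] by (simp add: Int_commute)
  ultimately show ?thesis by (simp add: k_def)
qed

lemma sum_degree_le_prefix:
  assumes "has_degree_sequence G d" "finite (verts G)" "sorted_wrt (\<ge>) d" "X \<subseteq> verts G"
  shows "(\<Sum>v\<in>X. degree G v) \<le> (\<Sum>i = 0..<card X. d ! i)"
proof -
  obtain h where h: "bij_betw h {..<length d} (verts G)"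
    "\<And>i. i < length d \<Longrightarrow> degree G (h i) = d ! i"
    using degree_sequence_enumeration[OF assms(1,2)] by blast
  define I where "I = {i \<in> {..<length d}. h i \<in> X}"
  have bij: "bij_betw h I X"
    using h(1) assms(4) by (auto simp: I_def bij_betw_def inj_on_def image_iff)
  have "(\<Sum>v\<in>X. degree G v) = (\<Sum>i\<in>I. degree G (h i))"
    by (rule sum.reindex_bij_betw[OF bij, symmetric])
  also have "\<dots> = (\<Sum>i\<in>I. d ! i)" using h(2) by (intro sum.cong) (auto simp: I_def)
  also have "\<dots> \<le> (\<Sum>i = 0..<card I. d ! i)"
    using assms(3) by (intro sum_nth_le_prefix) (auto simp: I_def)
  finally show ?thesis using bij_betw_same_card[OF bij] by simp
qed

lemma sum_degree_eq_sum_list: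
  assumes "has_degree_sequence G d"
  shows "(\<Sum>v\<in>verts G. degree G v) = sum_list d"
  using assms by (simp add: has_degree_sequence_def sum_unfold_sum_mset sum_mset_sum_list)

lemma card_verts_eq_length:
  assumes "has_degree_sequence G d"
  shows "card (verts G) = length d"
  using arg_cong[OF assms[unfolded has_degree_sequence_def], of size] by simp

lemma card_degree_ge2:
  assumes "has_degree_sequence G d" "finite (verts G)"
  shows "card {v \<in> verts G. degree G v \<ge> 2} = n_ge2 d"
proof -
  have "card {v \<in> verts G. degree G v \<ge> 2}
      = size (filter_mset (\<lambda>x. x \<ge> 2) (image_mset (degree G) (mset_set (verts G))))"
    by (simp add: filter_mset_image_mset filter_mset_mset_set[OF assms(2)] o_def)
  also have "\<dots> = size (filter_mset (\<lambda>x. x \<ge> 2) (mset d))"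
    using assms(1) by (simp add: has_degree_sequence_def)
  also have "\<dots> = n_ge2 d" by (simp add: n_ge2_def flip: mset_filter)
  finally show ?thesis .
qed

lemma sum_split_prefix:
  fixes d :: "nat list"
  assumes "k \<le> length d"
  shows "(\<Sum>i = 0..<k. d ! i) + (\<Sum>i = k..<length d. d ! i) = sum_list d"
  using assms by (simp add: sum_list_sum_nth sum.atLeastLessThan_concat)

section \<open>Lower bound\<close>

text \<open>The alternatives lead to \<open>k1\<close> and \<open>k2\<close>. They are stated
  additively to avoid truncated subtraction.\<close>

lemma dominating_set_balance:
  assumes F: "forest F" and ds: "has_degree_sequence F d" and sorted: "sorted_wrt (\<ge>) d"
    and D: "dominating_set F D"
  shows "length d \<le> (\<Sum>i = 0..<card D. d ! i) + card D"
    and "(\<Sum>i = card D..<length d. d ! i) \<le> (\<Sum>i = 0..<card D. d ! i) \<or>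
      (\<Sum>i = card D..<length d. d ! i) + 2 * card D + 2 \<le> (\<Sum>i = 0..<card D. d ! i) + 2 * n_ge2 d"
proof -
  have sF: "simple_graph F" and fV: "finite (verts F)"
    using F by (auto simp: forest_def simple_graph_def)
  have DV: "D \<subseteq> verts F" using D by (simp add: dominating_set_def)
  then have fD: "finite D" using fV finite_subset by blast
  define k where "k = card D"
  define S where "S = (\<Sum>i = 0..<k. d ! i)"
  define T where "T = (\<Sum>i = k..<length d. d ! i)"
  have card_V: "card (verts F) = length d" by (rule card_verts_eq_length[OF ds])
  have k_le: "k \<le> length d" using card_mono[OF fV DV] card_V by (simp add: k_def)
  have prefix: "(\<Sum>v\<in>X. degree F v) \<le> S" if "X \<subseteq> verts F" "card X = k" for X
    using sum_degree_le_prefix[OF ds fV sorted that(1)] that(2) by (simp add: S_def)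
  have "length d - k \<le> S"
    using card_le_sum_degree_dominating[OF sF D] prefix[OF DV] card_Diff_subset[OF fD DV] card_V
    by (simp add: k_def)
  then show "length d \<le> (\<Sum>i = 0..<card D. d ! i) + card D"
    by (simp add: S_def k_def)
  let ?U = "verts F - D"
  define sD where "sD = (\<Sum>v\<in>D. degree F v)"
  define sU where "sU = (\<Sum>v\<in>?U. degree F v)"
  \<comment> \<open>\<open>P\<close> collects the vertices of \<open>D\<close> that
    \<open>n_ge2\<close> misses; \<open>Q\<close> turns out to contain every edge that avoids
    \<open>D\<close>.\<close>
  define P where "P = {v \<in> D. degree F v < 2}"
  define Q where "Q = {v \<in> ?U. degree F v \<ge> 2}"
  define M where "M = {e \<in> edges F. e \<subseteq> ?U}"
  have fin: "finite P" "finite Q" using fD fV by (auto simp: P_def Q_def)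
  have total: "S + T = sD + sU"
    using sum_split_prefix[OF k_le] sum_degree_eq_sum_list[OF ds] sum.subset_diff[OF DV fV, of "degree F"]
    by (simp add: S_def T_def sD_def sU_def)
  have n2: "n_ge2 d + card P = card Q + k"
  proof -
    have "{v \<in> verts F. degree F v \<ge> 2} = Q \<union> (D - P)"
      using DV by (auto simp: P_def Q_def)
    then have "n_ge2 d = card (Q \<union> (D - P))" using card_degree_ge2[OF ds fV] by simp
    also have "\<dots> = card Q + card (D - P)"
      using fin fD by (intro card_Un_disjoint) (auto simp: Q_def)
    also have "card (D - P) = k - card P"
      using fin by (simp add: card_Diff_subset P_def k_def)
    finally show ?thesis using card_mono[OF fD, of P] by (simp add: P_def k_def)
  qed
  have sU_le: "sU \<le> sD + 2 * card M"
    using sum_degree_complement_le[OF sF DV] by (simp add: sU_def sD_def M_def)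
  text \<open>An endpoint of an edge avoiding \<open>D\<close> has a further neighbour in \<open>D\<close>, hence degree at least 2.\<close>
  have M_Q: "e \<subseteq> Q" if "e \<in> M" for e
  proof
    fix x assume x: "x \<in> e"
    obtain y where y: "e = {y, x}" "y \<in> ?U" "x \<in> ?U" "y \<noteq> x"
    proof -
      obtain a b where "e = {a, b}" "a \<noteq> b"
        using simple_edge_cases[OF sF] \<open>e \<in> M\<close> by (auto simp: M_def)
      with x \<open>e \<in> M\<close> show thesis using that by (auto simp: M_def insert_commute)
    qed
    obtain w where w: "w \<in> D" "w \<in> neighbors F x"
      using D y(3) by (auto simp: dominating_set_def)
    have "{y, w} \<subseteq> neighbors F x" using y(1) w \<open>e \<in> M\<close> by (auto simp: M_def neighbors_def)
    then have "card {y, w} \<le> degree F x"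
      unfolding degree_def by (intro card_mono finite_neighbors[OF sF])
    moreover have "card {y, w} = 2" using y w by auto
    ultimately show "x \<in> Q" using y(3) by (simp add: Q_def)
  qed
  have M_less: "card M < card Q" if "Q \<noteq> {}"
  proof -
    have "forest (verts F, edges F)" using F by simp
    then have "forest (Q, M)"
      using M_Q by (intro forest_subgraph[of _ _ Q M]) (auto simp: Q_def M_def)
    then show ?thesis using that by (rule card_forest_edges_less)
  qed
  define r where "r = min (card P) (card Q)"
  obtain P' where P': "P' \<subseteq> P" "card P' = r"
    using obtain_subset_with_card_n[of r P] by (auto simp: r_def)
  obtain Q' where Q': "Q' \<subseteq> Q" "card Q' = r"
    using obtain_subset_with_card_n[of r Q] by (auto simp: r_def)
  text \<open>Exchanging low-degree vertices of \<open>D\<close> for vertices of \<open>Q\<close> increases the degree sum,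
    which compensates for the vertices of \<open>D\<close> that \<open>n_ge2\<close> does not count.\<close>
  have "sD + r \<le> S"
  proof -
    have sub: "P' \<subseteq> D" "Q' \<subseteq> ?U" using P' Q' by (auto simp: P_def Q_def)
    have finPQ: "finite P'" "finite Q'" using P' Q' fin finite_subset by blast+
    have disj: "(D - P') \<inter> Q' = {}" using sub by blast
    have "card ((D - P') \<union> Q') = card (D - P') + card Q'"
      using disj fD finPQ by (intro card_Un_disjoint) auto
    also have "\<dots> = k"
      using card_Diff_subset[OF finPQ(1) sub(1)] card_mono[OF fD sub(1)] P' Q' by (simp add: k_def)
    finally have "(\<Sum>v\<in>(D - P') \<union> Q'. degree F v) \<le> S"
      using sub DV by (intro prefix) auto
    moreover have "(\<Sum>v\<in>(D - P') \<union> Q'. degree F v)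
        = (\<Sum>v\<in>D - P'. degree F v) + (\<Sum>v\<in>Q'. degree F v)"
      using disj fD finPQ by (intro sum.union_disjoint) auto
    moreover have "sD = (\<Sum>v\<in>D - P'. degree F v) + (\<Sum>v\<in>P'. degree F v)"
      unfolding sD_def by (rule sum.subset_diff[OF sub(1) fD])
    moreover have "(\<Sum>v\<in>P'. degree F v) \<le> r"
    proof -
      have "degree F v \<le> 1" if "v \<in> P'" for v using P'(1) that by (auto simp: P_def)
      then show ?thesis using sum_bounded_above[of P' "degree F" 1] P'(2) by simp
    qed
    moreover have "2 * r \<le> (\<Sum>v\<in>Q'. degree F v)"
    proof -
      have "2 \<le> degree F v" if "v \<in> Q'" for v using Q'(1) that by (auto simp: Q_def)
      then show ?thesis using sum_bounded_below[of Q' 2 "degree F"] Q'(2) by simp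
    qed
    ultimately show ?thesis by simp
  qed
  have "T \<le> S \<or> T + 2 * k + 2 \<le> S + 2 * n_ge2 d"
  proof (cases "Q = {}")
    case True
    have "e \<notin> M" for e
    proof
      assume "e \<in> M"
      then have "e = {}" "card e = 2" using M_Q True sF by (auto simp: M_def simple_graph_def)
      then show False by simp
    qed
    then have "M = {}" by blast
    then show ?thesis using sU_le total \<open>sD + r \<le> S\<close> by simp
  next
    case False
    \<comment> \<open>Together, \<open>T - S\<close> is at most
      \<open>2 * card Q - 2 - 2 * r\<close>. For \<open>r = card P\<close> this is the second
      alternative by \<open>n2\<close>; for \<open>r = card Q\<close> it is negative.\<close>
    from M_less[OF this] sU_le total \<open>sD + r \<le> S\<close> n2 show ?thesis
      by (auto simp: r_def min_def split: if_splits)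
  qed
  then show "(\<Sum>i = card D..<length d. d ! i) \<le> (\<Sum>i = 0..<card D. d ! i) \<or>
      (\<Sum>i = card D..<length d. d ! i) + 2 * card D + 2 \<le> (\<Sum>i = 0..<card D. d ! i) + 2 * n_ge2 d"
    by (simp add: S_def T_def k_def)
qed

lemma k1_le:
  assumes "k \<in> {1..length d}" "(\<Sum>i = k..<length d. d ! i) \<le> (\<Sum>i = 0..<k. d ! i)"
  shows "k1 d \<le> enat k"
  unfolding k1_def using assms by (intro Inf_lower) auto

text \<open>Only the nonzero branch of the maximum is treated: equality of the two sums already
  falls under \<open>k1\<close>.\<close>

lemma k2_le:
  assumes "k \<in> {1..length d}" "length d \<le> (\<Sum>i = 0..<k. d ! i) + k"
    and "(\<Sum>i = 0..<k. d ! i) \<le> (\<Sum>i = k..<length d. d ! i)"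
    and "(\<Sum>i = k..<length d. d ! i) + 2 * k + 2 \<le> (\<Sum>i = 0..<k. d ! i) + 2 * n_ge2 d"
  shows "k2 d \<le> enat k"
proof -
  let ?S = "\<Sum>i = 0..<k. d ! i" and ?T = "\<Sum>i = k..<length d. d ! i"
  have "int (length d) \<le> int ?S + int k" "int ?S \<le> int ?T"
    "int ?T + 2 * int k + 2 \<le> int ?S + 2 * int (n_ge2 d)"
    using assms(2-4) by linarith+
  then show ?thesis
    unfolding k2_def using assms(1) by (intro Inf_lower imageI) (auto simp: max_def)
qed

lemma min_k1_k2_le_gamma_min:
  assumes "d \<noteq> []" "sorted_wrt (\<ge>) d"
  shows "min (k1 d) (k2 d) \<le> gamma_min d"
  unfolding gamma_min_def
proof (rule INF_greatest)
  fix F assume F: "F \<in> forests d"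
  then have fF: "forest F" and ds: "has_degree_sequence F d" by (auto simp: forests_def)
  then have sF: "simple_graph F" by (simp add: forest_def)
  obtain D where D: "dominating_set F D" "card D = domination_number F"
    using domination_number_attained[OF sF] by blast
  define k where "k = card D"
  note bal = dominating_set_balance[OF fF ds assms(2) D(1), folded k_def]
  \<comment> \<open>Both minima range over positive \<open>k\<close>; an empty \<open>D\<close>
    would force \<open>length d\<close> to be 0.\<close>
  have "k \<noteq> 0" using bal(1) assms(1) by (intro notI) simp
  moreover have "k \<le> length d"
    using D(1) sF card_mono[of "verts F" D] card_verts_eq_length[OF ds]
    by (simp add: k_def dominating_set_def simple_graph_def)
  ultimately have k: "k \<in> {1..length d}" by simp
  have "k1 d \<le> enat k \<or> k2 d \<le> enat k"
    using k1_le[OF k] k2_le[OF k] bal by linarith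
  then show "min (k1 d) (k2 d) \<le> enat (domination_number F)"
    using D(2) by (auto simp: k_def min_le_iff_disj)
qed

section \<open>Upper bound\<close>

text \<open>The list positions serve as vertices and the first \<open>k\<close> of them dominate.
  The heavier side \<open>W\<close> is the prefix for \<open>k1\<close> and the suffix for
  \<open>k2\<close>.\<close>

lemma gamma_min_le:
  assumes k: "k \<le> length d" and W: "W = {0..<k} \<or> W = {k..<length d}"
    and pos: "\<And>i. i < length d \<Longrightarrow> d ! i > 0"
    and balance: "(\<Sum>i\<in>W. d ! i) = (\<Sum>i\<in>{0..<length d} - W. d ! i) + 2 * j"
    and few: "sum_list d + 2 \<le> 2 * length d"
    and cap: "2 * j \<le> (\<Sum>i\<in>W. d ! i - 1)"
    and classes: "j = 0 \<or> j + 1 \<le> card {i \<in> W. d ! i \<ge> 2}"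
  shows "gamma_min d \<le> enat k"
proof -
  let ?V = "{0..<length d}"
  have "\<exists>E. forest (?V, E) \<and> (\<forall>v\<in>?V. degree (?V, E) v = d ! v) \<and> dominating_set (?V, E) {0..<k}"
  proof (rule ex_forest_dominated[of ?V "{0..<k}" "{k..<length d}"])
    show "(\<Sum>v\<in>?V. d ! v) + 2 \<le> 2 * card ?V" using few by (simp add: sum_list_sum_nth)
  qed (use assms in auto)
  then obtain E where E: "forest (?V, E)" "\<And>v. v \<in> ?V \<Longrightarrow> degree (?V, E) v = d ! v"
    "dominating_set (?V, E) {0..<k}" by blast
  have "image_mset (degree (?V, E)) (mset_set ?V) = image_mset ((!) d) (mset_set ?V)"
    using E(2) by (intro image_mset_cong) auto
  also have "\<dots> = mset (map ((!) d) [0..<length d])" by simp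
  finally have "(?V, E) \<in> forests d"
    using E(1) by (simp add: forests_def has_degree_sequence_def map_nth)
  then have "gamma_min d \<le> enat (domination_number (?V, E))"
    unfolding gamma_min_def by (rule INF_lower)
  also have "\<dots> \<le> enat k"
    using domination_number_le[OF _ E(3)] E(1) by (simp add: forest_def)
  finally show ?thesis .
qed

text \<open>The suffix is the heavier side, and each condition in \<open>k2\<close> supplies one
  requirement of the construction: \<open>n_le\<close> the capacity, \<open>slack\<close> the number
  of components.\<close>

lemma gamma_min_le_k2:
  assumes pos: "\<And>i. i < length d \<Longrightarrow> d ! i > 0"
    and few: "sum_list d + 2 \<le> 2 * length d" and ev: "even (sum_list d)"
  shows "gamma_min d \<le> k2 d"
  unfolding k2_def
proof (rule Inf_greatest, elim imageE)
  fix y k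
  define S where "S = (\<Sum>i = 0..<k. d ! i)"
  define T where "T = (\<Sum>i = k..<length d. d ! i)"
  assume y: "y = enat k" and "k \<in> {k \<in> {1..length d}.
     (\<Sum>i = 0..<k. int (d ! i)) \<ge> int (length d) - int k \<and>
     0 \<le> (\<Sum>i = k..<length d. int (d ! i)) - (\<Sum>i = 0..<k. int (d ! i)) \<and>
     (\<Sum>i = k..<length d. int (d ! i)) - (\<Sum>i = 0..<k. int (d ! i))
       \<le> max 0 (2 * (int (n_ge2 d) - int k) - 2)}"
  then have k: "k \<le> length d" and "int S \<ge> int (length d) - int k" "int S \<le> int T"
    "int T - int S \<le> max 0 (2 * (int (n_ge2 d) - int k) - 2)"
    by (auto simp: S_def T_def)
  then have n_le: "length d \<le> S + k" and ST: "S \<le> T"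
    and slack: "T = S \<or> T + 2 * k + 2 \<le> S + 2 * n_ge2 d"
    by (auto simp: max_def split: if_splits)
  have total: "S + T = sum_list d" unfolding S_def T_def by (rule sum_split_prefix[OF k])
  with ev have "even (T - S)" using ST by (metis even_add even_diff_nat)
  then obtain j where "T - S = 2 * j" by (elim evenE)
  with ST have j: "T = S + 2 * j" by simp
  let ?W = "{k..<length d}"
  have "gamma_min d \<le> enat k"
  proof (rule gamma_min_le[OF k disjI2[OF refl] pos _ few])
    have "{0..<length d} - ?W = {0..<k}" using k by auto
    then show "(\<Sum>i\<in>?W. d ! i) = (\<Sum>i\<in>{0..<length d} - ?W. d ! i) + 2 * j"
      using j by (simp add: S_def T_def)
    \<comment> \<open>Holding back one unit per suffix entry leaves
      \<open>T - (length d - k)\<close>, which is at least \<open>T - S\<close> by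
      \<open>n_le\<close>.\<close>
    have "T = (\<Sum>i\<in>?W. (d ! i - 1) + 1)"
      unfolding T_def using pos by (intro sum.cong) (auto simp: Suc_leI)
    also have "\<dots> = (\<Sum>i\<in>?W. d ! i - 1) + (length d - k)"
      by (simp only: sum.distrib) simp
    finally show "2 * j \<le> (\<Sum>i\<in>?W. d ! i - 1)" using j n_le by simp
    have "{i. i < length d \<and> 2 \<le> d ! i} \<subseteq> {0..<k} \<union> {i \<in> ?W. d ! i \<ge> 2}" by auto
    then have "card {i. i < length d \<and> 2 \<le> d ! i} \<le> card ({0..<k} \<union> {i \<in> ?W. d ! i \<ge> 2})"
      by (intro card_mono) auto
    also have "\<dots> \<le> card {0..<k} + card {i \<in> ?W. d ! i \<ge> 2}" by (rule card_Un_le)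
    finally have "n_ge2 d \<le> k + card {i \<in> ?W. d ! i \<ge> 2}"
      by (simp add: n_ge2_def length_filter_conv_card)
    then show "j = 0 \<or> j + 1 \<le> card {i \<in> ?W. d ! i \<ge> 2}" using slack j by auto
  qed
  then show "gamma_min d \<le> y" using y by simp
qed

text \<open>At the least admissible \<open>k\<close> the excess \<open>2 * j\<close> of the prefix
  is so small that all its entries exceed \<open>j\<close>, while \<open>few\<close> gives
  \<open>j < k\<close>.\<close>

lemma gamma_min_le_k1:
  assumes sorted: "sorted_wrt (\<ge>) d" and pos: "\<And>i. i < length d \<Longrightarrow> d ! i > 0"
    and few: "sum_list d + 2 \<le> 2 * length d" and ev: "even (sum_list d)"
  shows "gamma_min d \<le> k1 d"
  unfolding k1_def
proof (rule Inf_greatest, elim imageE)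
  let ?P = "\<lambda>k. k \<in> {1..length d} \<and> (\<Sum>i = k..<length d. d ! i) \<le> (\<Sum>i = 0..<k. d ! i)"
  fix y k0
  assume y: "y = enat k0" and k0: "k0 \<in> {k \<in> {1..length d}.
    (\<Sum>i = 0..<k. d ! i) \<ge> (\<Sum>i = k..<length d. d ! i)}"
  define k where "k = (LEAST k. ?P k)"
  have "?P k0" using k0 by simp
  then have "?P k" "k \<le> k0" unfolding k_def by (rule LeastI, rule Least_le)
  have k_min: "\<not> ?P (k - 1)" using \<open>?P k\<close> not_less_Least[of "k - 1" ?P] by (auto simp: k_def)
  have k: "0 < k" "k \<le> length d" using \<open>?P k\<close> by auto
  define S where "S = (\<Sum>i = 0..<k. d ! i)"
  define T where "T = (\<Sum>i = k..<length d. d ! i)"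
  have ST: "T \<le> S" using \<open>?P k\<close> by (simp add: S_def T_def)
  have total: "S + T = sum_list d" unfolding S_def T_def by (rule sum_split_prefix[OF k(2)])
  with ev have "even (S - T)" using ST by (metis even_add even_diff_nat)
  then obtain j where "S - T = 2 * j" by (elim evenE)
  with ST have j: "S = T + 2 * j" by simp
  define x where "x = d ! (k - 1)"
  have S_eq: "S = (\<Sum>i = 0..<k - 1. d ! i) + x"
    unfolding S_def x_def using k(1) by (cases k) simp_all
  have T_eq: "(\<Sum>i = k - 1..<length d. d ! i) = x + T"
    unfolding T_def x_def using k by (subst sum.atLeast_Suc_lessThan) simp_all
  have "x > 0" unfolding x_def using k by (intro pos) simp
  \<comment> \<open>Moving the last prefix entry \<open>x\<close> to the other side reverses the
    inequality, by minimality of \<open>k\<close>. For \<open>k = 1\<close> minimality says nothing,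
    but then \<open>S = x\<close>.\<close>
  have "S < x + T + x"
  proof (cases "k - 1 = 0")
    case True
    then show ?thesis using S_eq \<open>x > 0\<close> by simp
  next
    case False
    then show ?thesis using k_min k S_eq T_eq by auto
  qed
  then have jx: "j + 1 \<le> x" using j by simp
  have "length d - k \<le> T"
    using sum_bounded_below[of "{k..<length d}" 1 "\<lambda>i. d ! i"] pos by (simp add: T_def Suc_leI)
  then have jk: "j + 1 \<le> k" using few total j by simp
  have ge_x: "x \<le> d ! i" if "i < k" for i
  proof (cases "i = k - 1")
    case False
    with that k have "i < k - 1" "k - 1 < length d" by auto
    then show ?thesis using sorted_wrt_nth_less[OF sorted] by (simp add: x_def)
  qed (simp add: x_def)
  let ?W = "{0..<k}"
  have "gamma_min d \<le> enat k"
  proof (rule gamma_min_le[OF k(2) disjI1[OF refl] pos _ few])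
    have "{0..<length d} - ?W = {k..<length d}" by auto
    then show "(\<Sum>i\<in>?W. d ! i) = (\<Sum>i\<in>{0..<length d} - ?W. d ! i) + 2 * j"
      using j by (simp add: S_def T_def)
    \<comment> \<open>Either \<open>j = 0\<close> or \<open>j + 1\<close> is at least 2. Each of the
      \<open>k\<close> prefix entries then offers \<open>j\<close> units beyond the one held
      back.\<close>
    have "2 * j \<le> (j + 1) * j" by (cases j) simp_all
    also have "\<dots> \<le> k * j" using jk by (rule mult_le_mono1)
    also have "\<dots> \<le> (\<Sum>i\<in>?W. d ! i - 1)"
    proof -
      have "j \<le> d ! i - 1" if "i \<in> ?W" for i using ge_x[of i] that jx by simp
      then show ?thesis using sum_bounded_below[of ?W j "\<lambda>i. d ! i - 1"] by simp
    qed
    finally show "2 * j \<le> (\<Sum>i\<in>?W. d ! i - 1)" .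
    have "k \<le> card {i \<in> ?W. d ! i \<ge> 2}" if "j \<noteq> 0"
    proof -
      have "2 \<le> d ! i" if "i < k" for i using ge_x[OF that] jx \<open>j \<noteq> 0\<close> by simp
      then have "{i \<in> ?W. d ! i \<ge> 2} = ?W" by auto
      then show ?thesis by (simp only: card_atLeastLessThan diff_zero order_refl)
    qed
    then show "j = 0 \<or> j + 1 \<le> card {i \<in> ?W. d ! i \<ge> 2}" using jk order_trans by blast
  qed
  also have "enat k \<le> y" using y \<open>k \<le> k0\<close> by simp
  finally show "gamma_min d \<le> y" .
qed

theorem corollary10:
  fixes d :: "nat list"
  assumes "d \<noteq> []"
    and "sorted_wrt (\<ge>) d"
    and "\<exists>F \<in> forests d. \<forall>v \<in> verts F. neighbors F v \<noteq> {}"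
  shows "gamma_min d = min (k1 d) (k2 d)"
proof (rule antisym)
  obtain F :: "nat ugraph" where F: "forest F" "has_degree_sequence F d" "\<forall>v \<in> verts F. neighbors F v \<noteq> {}"
    using assms(3) by (auto simp: forests_def)
  have sF: "simple_graph F" and fV: "finite (verts F)"
    using F(1) by (auto simp: forest_def simple_graph_def)
  \<comment> \<open>From the given forest the upper bound takes only arithmetic: an even degree sum,
    at most \<open>2 * length d - 2\<close>, with positive entries.\<close>
  have sum_d: "sum_list d = 2 * card (edges F)"
    using handshake[OF sF] sum_degree_eq_sum_list[OF F(2)] by simp
  have "card (edges F) < length d"
    using card_forest_edges_less[of "verts F" "edges F"] F(1) assms(1) card_verts_eq_length[OF F(2)]
    by (metis card.empty length_0_conv prod.collapse)
  then have few: "sum_list d + 2 \<le> 2 * length d" using sum_d by simp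
  have ev: "even (sum_list d)" using sum_d by simp
  have pos: "d ! i > 0" if "i < length d" for i
  proof -
    obtain h where h: "bij_betw h {..<length d} (verts F)"
      "\<And>i. i < length d \<Longrightarrow> degree F (h i) = d ! i"
      using degree_sequence_enumeration[OF F(2) fV] by blast
    have "neighbors F (h i) \<noteq> {}" using F(3) bij_betwE[OF h(1)] that by blast
    then show ?thesis
      using finite_neighbors[OF sF, of "h i"]
      by (simp add: degree_def card_gt_0_iff flip: h(2)[OF that])
  qed
  show "gamma_min d \<le> min (k1 d) (k2 d)"
    using gamma_min_le_k1[OF assms(2) pos few ev] gamma_min_le_k2[OF pos few ev] by simp
  show "min (k1 d) (k2 d) \<le> gamma_min d"
    using assms(1,2) by (rule min_k1_k2_le_gamma_min)
qed

end
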